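(* Let $k\ge2$, let $\beta_1,\dots,\beta_r\in\mathbb R$, let $\mathbf H_s=(H_s,\sigma_s)$, $s=1,\dots,r$, be finite simple $k$-colored graphs, and let $T(\mathbf W)=\sum_{s=1}^r\beta_st(\mathbf H_s,\mathbf W)$ for $\mathbf W\in\mathcal W_k$. Define $$\Lambda:=\sum_{s=1}^r|\beta_s|\,(|E(H_s)|-1)\max_{1\le a\ne b\le k}\big(|E_a(H_s)|+|E_b(H_s)|\big).$$ If $\Lambda<2$, then the variational problem $\sup_{\mathbf W\in\mathcal W_k}\{T(\mathbf W)-\frac12\mathcal I(\mathbf W)\}$ has a unique maximizer $\mathbf W^\star$ (up to almost everywhere equality). Consequently, this maximizer is constant: there exists $\mu^\star\in\Delta_k$ such that $\mathbf W^\star(x,y)=\mu^\star$ for almost every $(x,y)\in[0,1]^2$.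
   Context: Let $[k]=\{1,\dots,k\}$ and $\Delta_k=\{\mu\in[0,1]^k:\sum_a\mu_a=1\}$. A $k$-colored probability graphon is a measurable symmetric map $\mathbf W=(W_1,\dots,W_k):[0,1]^2\to\Delta_k$; $\mathcal W_k$ is the set of these. A $k$-colored graph $\mathbf H=(H,\sigma)$ is a finite simple graph $H$ with a map $\sigma:E(H)\to[k]$; $E_a(H)=\{e\in E(H):\sigma(e)=a\}$ is the set of edges of color $a$, and $$t(\mathbf H,\mathbf W)=\int_{[0,1]^{V(H)}}\prod_{(u,v)\in E(H)}W_{\sigma((u,v))}(x_u,x_v)\prod_{v\in V(H)}dx_v .$$ $\mathcal I(\mathbf W)=\sum_{a=1}^k\int_{[0,1]^2}W_a\log W_a\,dx\,dy$, with $0\log0=0$. *)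

theory Defs
  imports "HOL-Analysis.Analysis"
begin

text \<open>Colors are the elements of a finite type \<open>'k\<close>, so that \<open>k = CARD('k)\<close> and
  \<open>\<Delta>\<^sub>k\<close> is a subset of \<open>real ^ 'k\<close>.\<close>

definition color_simplex :: "(real ^ 'k::finite) set" where
  "color_simplex = {\<mu>. (\<forall>a. \<mu> $ a \<in> {0..1}) \<and> (\<Sum>a\<in>UNIV. \<mu> $ a) = 1}"

definition unit_interval :: "real measure" where
  "unit_interval = restrict_space lborel {0..1}"

definition unit_square :: "(real \<times> real) measure" where
  "unit_square = restrict_space lborel ({0..1} \<times> {0..1})"

text \<open>Functions are total, so a probability graphon is unconstrained outside the unit square;
  nothing below depends on its values there.\<close>

definition prob_graphons :: "(real \<times> real \<Rightarrow> real ^ 'k::finite) set" where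
  "prob_graphons = {W. W \<in> borel_measurable unit_square \<and>
     (\<forall>x\<in>{0..1}. \<forall>y\<in>{0..1}. W (x, y) \<in> color_simplex \<and> W (x, y) = W (y, x))}"

text \<open>Edges are two-element sets of vertices; \<open>color\<close> is only relevant on \<open>edges\<close>.\<close>

record ('v, 'k) cgraph =
  verts :: "'v set"
  edges :: "'v set set"
  color :: "'v set \<Rightarrow> 'k"

definition finite_simple_cgraph :: "('v, 'k) cgraph \<Rightarrow> bool" where
  "finite_simple_cgraph H \<longleftrightarrow>
     finite (verts H) \<and> edges H \<subseteq> {e. e \<subseteq> verts H \<and> card e = 2}"

definition edges_of_color :: "('v, 'k) cgraph \<Rightarrow> 'k \<Rightarrow> 'v set set" where
  "edges_of_color H a = {e \<in> edges H. color H e = a}"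

definition edge_ends :: "'v set \<Rightarrow> 'v \<times> 'v" where
  "edge_ends e = (SOME (u, v). e = {u, v})"

text \<open>The order of the two ends is an arbitrary choice, which is immaterial because
  \<open>W\<close> is symmetric.\<close>

definition edge_weight ::
  "(real \<times> real \<Rightarrow> real ^ 'k::finite) \<Rightarrow> 'k \<Rightarrow> ('v \<Rightarrow> real) \<Rightarrow> 'v set \<Rightarrow> real" where
  "edge_weight W a x e = (case edge_ends e of (u, v) \<Rightarrow> W (x u, x v) $ a)"

lemma edge_weight_pair:
  assumes "W \<in> prob_graphons" "x u \<in> {0..1}" "x v \<in> {0..1}"
  shows "edge_weight W a x {u, v} = W (x u, x v) $ a"
proof -
  have "case edge_ends {u, v} of (p, q) \<Rightarrow> {u, v} = {p, q}"
    unfolding edge_ends_def by (rule someI[where x = "(u, v)"]) simp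
  then have "edge_ends {u, v} = (u, v) \<or> edge_ends {u, v} = (v, u)"
    by (auto simp: doubleton_eq_iff split: prod.splits)
  moreover have "W (x u, x v) = W (x v, x u)"
    using assms unfolding prob_graphons_def by blast
  ultimately show ?thesis
    by (auto simp: edge_weight_def)
qed

definition hom_density ::
  "('v, 'k::finite) cgraph \<Rightarrow> (real \<times> real \<Rightarrow> real ^ 'k) \<Rightarrow> real" where
  "hom_density H W =
     (LINT x | PiM (verts H) (\<lambda>_. unit_interval).
        (\<Prod>e\<in>edges H. edge_weight W (color H e) x e))"

text \<open>A vanishing \<open>W\<^sub>a\<close> contributes \<open>0 * ln 0 = 0\<close>.\<close>

definition entropy_functional :: "(real \<times> real \<Rightarrow> real ^ 'k::finite) \<Rightarrow> real" where
  "entropy_functional W = (\<Sum>a\<in>UNIV. LINT p | unit_square. W p $ a * ln (W p $ a))"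

definition density_combination ::
  "nat \<Rightarrow> (nat \<Rightarrow> real) \<Rightarrow> (nat \<Rightarrow> ('v, 'k::finite) cgraph) \<Rightarrow>
     (real \<times> real \<Rightarrow> real ^ 'k) \<Rightarrow> real" where
  "density_combination r \<beta> H W = (\<Sum>s=1..r. \<beta> s * hom_density (H s) W)"

definition Lambda_const ::
  "nat \<Rightarrow> (nat \<Rightarrow> real) \<Rightarrow> (nat \<Rightarrow> ('v, 'k::finite) cgraph) \<Rightarrow> real" where
  "Lambda_const r \<beta> H =
     (\<Sum>s=1..r. \<bar>\<beta> s\<bar> * (real (card (edges (H s))) - 1) *
        real (Max {card (edges_of_color (H s) a) + card (edges_of_color (H s) b) | a b. a \<noteq> b}))"

end

theory Submission
  imports Defs "HOL-Probability.Probability" "HOL-Real_Asymp.Real_Asymp"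
begin

text \<open>Compactness of the space of graphons is not needed. Compare \<open>J W\<close> with the value of \<open>J\<close> at a
  constant \<open>q\<close>. Since each edge marginal of the product measure is uniform on the square, the
  first-order terms depend on \<open>W\<close> only through its mean; the second-order remainder of the densities is
  at most \<open>\<Lambda> / 8\<close> times the mean square of the pointwise \<open>\<ell>\<^sup>1\<close> distance \<open>\<parallel>W - q\<parallel>\<^sub>1\<close>, while Pinsker's
  inequality makes the entropy term lose at least \<open>1/4\<close> times the same quantity. With \<open>q\<close> the mean of
  \<open>W\<close> the first-order terms vanish, so replacing a graphon by its mean strictly increases \<open>J\<close> unless
  the graphon is constant. On constants a maximizer exists by compactness of the simplex; with \<open>q\<close> the
  midpoint of two constant maximizers the first-order terms cancel, so they coincide.\<close>

section \<open>Pointwise inequalities: products, weighted squares, relative entropy\<close>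

text \<open>Induction on the set of factors. Every remaining term of the expansion contains a
  product of two deviations \<open>w i - q i\<close>, bounded by half the sum of their squares; each
  index lies in \<open>card A - 1\<close> pairs, whence the constant. Adding a factor
  \<open>a\<close> turns the remainder \<open>R\<close> into \<open>q a * R\<close> plus the
  deviation at \<open>a\<close> times the difference of the old products, which telescopes.\<close>

lemma prod_first_order_remainder:
  fixes w q :: "'a \<Rightarrow> real"
  assumes "finite A" and "\<And>i. i \<in> A \<Longrightarrow> w i \<in> {0..1}" and "\<And>i. i \<in> A \<Longrightarrow> q i \<in> {0..1}"
  shows "\<bar>prod w A - prod q A - (\<Sum>i\<in>A. (w i - q i) * prod q (A - {i}))\<bar>
           \<le> (real (card A) - 1) / 2 * (\<Sum>i\<in>A. (w i - q i)\<^sup>2)"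
  using assms
proof (induction A)
  case empty
  then show ?case by simp
next
  case (insert a A)
  define R where "R = prod w A - prod q A - (\<Sum>i\<in>A. (w i - q i) * prod q (A - {i}))"
  define S where "S = (\<Sum>i\<in>A. (w i - q i)\<^sup>2)"
  have IH: "\<bar>R\<bar> \<le> (real (card A) - 1) / 2 * S"
    using insert by (simp add: R_def S_def)
  have "prod q (insert a A - {i}) = q a * prod q (A - {i})" if "i \<in> A" for i
  proof -
    have "insert a A - {i} = insert a (A - {i})" using that insert.hyps by auto
    then show ?thesis using insert.hyps by simp
  qed
  then have "(\<Sum>i\<in>A. (w i - q i) * prod q (insert a A - {i}))
      = q a * (\<Sum>i\<in>A. (w i - q i) * prod q (A - {i}))"
    by (simp add: sum_distrib_left mult_ac)
  moreover have "insert a A - {a} = A" using insert.hyps by auto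
  ultimately have expand: "prod w (insert a A) - prod q (insert a A)
      - (\<Sum>i\<in>insert a A. (w i - q i) * prod q (insert a A - {i}))
      = q a * R + (w a - q a) * (prod w A - prod q A)"
    using insert.hyps by (simp add: R_def algebra_simps)
  have "\<bar>prod w A - prod q A\<bar> \<le> (\<Sum>i\<in>A. \<bar>w i - q i\<bar>)"
    using norm_prod_diff[of A w q] insert.prems by simp
  then have "\<bar>(w a - q a) * (prod w A - prod q A)\<bar> \<le> \<bar>w a - q a\<bar> * (\<Sum>i\<in>A. \<bar>w i - q i\<bar>)"
    by (simp add: abs_mult mult_left_mono)
  also have "\<dots> \<le> (\<Sum>i\<in>A. ((w a - q a)\<^sup>2 + (w i - q i)\<^sup>2) / 2)"
    unfolding sum_distrib_left
  proof (rule sum_mono)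
    fix i
    have "0 \<le> (\<bar>w a - q a\<bar> - \<bar>w i - q i\<bar>)\<^sup>2" by simp
    then show "\<bar>w a - q a\<bar> * \<bar>w i - q i\<bar> \<le> ((w a - q a)\<^sup>2 + (w i - q i)\<^sup>2) / 2"
      by (simp add: power2_diff)
  qed
  also have "\<dots> = (real (card A) * (w a - q a)\<^sup>2 + S) / 2"
    by (simp add: S_def sum.distrib flip: sum_divide_distrib)
  finally have "\<bar>(w a - q a) * (prod w A - prod q A)\<bar> \<le> (real (card A) * (w a - q a)\<^sup>2 + S) / 2" .
  moreover have "\<bar>q a * R\<bar> \<le> \<bar>R\<bar>"
    using insert.prems(2)[of a] by (simp add: abs_mult mult_left_le_one_le)
  ultimately have "\<bar>q a * R + (w a - q a) * (prod w A - prod q A)\<bar>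
      \<le> (real (card A) - 1) / 2 * S + (real (card A) * (w a - q a)\<^sup>2 + S) / 2"
    using IH by linarith
  \<comment> \<open>The leftover \<open>S / 2\<close> raises the coefficient of the old squares from
    \<open>(card A - 1) / 2\<close> to \<open>card A / 2\<close>, the coefficient already reached by
    the new square.\<close>
  also have "\<dots> = (real (card (insert a A)) - 1) / 2 * (\<Sum>i\<in>insert a A. (w i - q i)\<^sup>2)"
    using insert.hyps by (simp add: S_def field_simps)
  finally show ?case unfolding expand .
qed

text \<open>The left-hand side is convex in the positive part and in the negative part of \<open>u\<close>
  separately, so the extremal case is \<open>u = e\<^sub>a - e\<^sub>b\<close>.\<close>
lemma weighted_sum_squares_le:
  fixes n u :: "'k::finite \<Rightarrow> real"
  assumes "CARD('k) \<ge> 2" and "(\<Sum>a\<in>UNIV. u a) = 0"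
    and "\<And>a. n a \<ge> 0" and n_le: "\<And>a b. a \<noteq> b \<Longrightarrow> n a + n b \<le> M"
  shows "(\<Sum>a\<in>UNIV. n a * (u a)\<^sup>2) \<le> M / 4 * (\<Sum>a\<in>UNIV. \<bar>u a\<bar>)\<^sup>2"
proof -
  define P where "P = {a. u a > 0}"
  define N where "N = {a. u a \<le> 0}"
  define p where "p = (\<Sum>a\<in>P. u a)"
  have split: "sum f UNIV = sum f P + sum f N" for f :: "'k \<Rightarrow> real"
    by (subst sum.union_disjoint[symmetric]) (auto simp: P_def N_def intro!: sum.cong)
  have N: "(\<Sum>a\<in>N. \<bar>u a\<bar>) = p"
  proof -
    have "(\<Sum>a\<in>N. \<bar>u a\<bar>) = - (\<Sum>a\<in>N. u a)"
      unfolding sum_negf[symmetric] by (intro sum.cong) (auto simp: N_def)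
    then show ?thesis using assms(2) split[of u] by (simp add: p_def)
  qed
  have P: "(\<Sum>a\<in>P. \<bar>u a\<bar>) = p"
    unfolding p_def by (intro sum.cong) (auto simp: P_def)
  \<comment> \<open>Positive and negative part have the same mass \<open>p\<close>, so no entry
    exceeds \<open>p\<close> in absolute value and one factor of each square can be replaced by
    \<open>p\<close>. The total mass is \<open>2 * p\<close>, which explains the 4 in the
    denominator of the claim.\<close>
  have half: "(\<Sum>a\<in>X. n a * (u a)\<^sup>2) \<le> c * p\<^sup>2"
    if "\<And>a. a \<in> X \<Longrightarrow> n a \<le> c" "(\<Sum>a\<in>X. \<bar>u a\<bar>) = p" "c \<ge> 0" for X c
  proof -
    have "(\<Sum>a\<in>X. n a * (u a)\<^sup>2) \<le> (\<Sum>a\<in>X. c * (\<bar>u a\<bar> * p))"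
    proof (rule sum_mono)
      fix a assume "a \<in> X"
      then have "\<bar>u a\<bar> \<le> p"
        using that(2) member_le_sum[of a X "\<lambda>a. \<bar>u a\<bar>"] by simp
      then have "(u a)\<^sup>2 \<le> \<bar>u a\<bar> * p"
        by (metis abs_ge_zero mult_left_mono power2_abs power2_eq_square)
      then show "n a * (u a)\<^sup>2 \<le> c * (\<bar>u a\<bar> * p)"
        using that(1)[OF \<open>a \<in> X\<close>] that(3) by (intro mult_mono) auto
    qed
    also have "\<dots> = c * p\<^sup>2"
      using that(2) by (simp add: power2_eq_square flip: sum_distrib_left sum_distrib_right)
    finally show ?thesis .
  qed
  have total: "(\<Sum>a\<in>UNIV. \<bar>u a\<bar>) = 2 * p"
    using split[of "\<lambda>a. \<bar>u a\<bar>"] N P by simp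
  show ?thesis
  proof (cases "P = {}")
    case True
    then have "p = 0" by (simp add: p_def)
    then have "u a = 0" for a
      using total by (simp add: sum_nonneg_eq_0_iff)
    then show ?thesis by simp
  next
    case False
    have "N \<noteq> {}"
    proof
      assume "N = {}"
      then have "(\<Sum>a\<in>P. \<bar>u a\<bar>) = 0" using N P by simp
      then have "\<forall>a\<in>P. u a = 0" by (subst (asm) sum_nonneg_eq_0_iff) auto
      then show False using False by (auto simp: P_def)
    qed
    \<comment> \<open>Take a color of largest weight on each side. The two sides are disjoint, so
      these colors differ and \<open>n_le\<close> applies to the pair.\<close>
    have "Max (n ` P) \<in> n ` P" "Max (n ` N) \<in> n ` N"
      using \<open>P \<noteq> {}\<close> \<open>N \<noteq> {}\<close> by (auto intro!: Max_in)
    then obtain a b where ab: "a \<in> P" "b \<in> N" "Max (n ` P) = n a" "Max (n ` N) = n b"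
      by auto
    have maxP: "n c \<le> n a" if "c \<in> P" for c
      unfolding ab(3)[symmetric] using that by (intro Max_ge) auto
    have maxN: "n c \<le> n b" if "c \<in> N" for c
      unfolding ab(4)[symmetric] using that by (intro Max_ge) auto
    have "(\<Sum>a\<in>UNIV. n a * (u a)\<^sup>2) \<le> n a * p\<^sup>2 + n b * p\<^sup>2"
      unfolding split using half[OF maxP P] half[OF maxN N] assms(3) by (meson add_mono)
    also have "\<dots> \<le> M * p\<^sup>2"
    proof -
      have "a \<noteq> b" using ab(1,2) by (auto simp: P_def N_def)
      then show ?thesis
        using n_le by (simp add: mult_right_mono flip: distrib_right)
    qed
    finally show ?thesis unfolding total by (simp add: power_mult_distrib)
  qed
qed

text \<open>The difference \<open>h\<close> of the two sides is convex, because its second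
  derivative is nonnegative by \<open>ln y \<le> y - 1\<close> at \<open>y = 1 / x\<close>. Both
  \<open>h\<close> and its derivative vanish at 1, so the tangent there is the zero line.\<close>

lemma x_ln_x_quadratic_bound:
  fixes x :: real
  assumes "x > 0"
  shows "3 * (x - 1)\<^sup>2 \<le> 2 * (x + 2) * (x * ln x - x + 1)"
proof -
  define h where "h = (\<lambda>x::real. 2 * (x + 2) * (x * ln x - x + 1) - 3 * (x - 1)\<^sup>2)"
  have 1: "(h has_real_derivative 4 * (x + 1) * ln x - 8 * (x - 1)) (at x)" if "x > 0" for x
    unfolding h_def using that
    by (auto intro!: derivative_eq_intros simp: field_simps power2_eq_square)
  have 2: "((\<lambda>x. 4 * (x + 1) * ln x - 8 * (x - 1)) has_real_derivative
      4 * (ln x + inverse x - 1)) (at x)" if "x > 0" for x :: real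
    using that by (auto intro!: derivative_eq_intros simp: field_simps)
  have 3: "4 * (ln x + inverse x - 1) \<ge> 0" if "x > 0" for x :: real
    using that ln_le_minus_one[of "inverse x"] by (simp add: ln_inverse)
  have "convex_on {0<..} h"
    using 1 2 3 by (intro f''_ge0_imp_convex) auto
  from convex_on_imp_above_tangent[OF this _ _ _ has_field_derivative_at_within[OF 1], of 1 x]
  have "h 1 \<le> h x"
    using assms by (simp add: interior_open)
  then show ?thesis by (simp add: h_def)
qed

text \<open>The previous bound at \<open>x = p / q\<close>, scaled by the square of
  \<open>q\<close>. This homogeneous form is what can be summed over the atoms of two
  distributions.\<close>

lemma ln_divergence_quadratic_bound:
  fixes p q :: real
  assumes "p \<ge> 0" "q > 0"
  shows "3 * (p - q)\<^sup>2 \<le> 2 * (p + 2 * q) * (p * (ln p - ln q) - p + q)"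
proof (cases "p = 0")
  case True
  then show ?thesis using assms by (simp add: power2_eq_square)
next
  case False
  have eq: "p * (ln p - ln q) - p + q = q * (p / q * ln (p / q) - p / q + 1)"
    using assms False by (simp add: ln_div field_simps)
  have "3 * (p - q)\<^sup>2 = q\<^sup>2 * (3 * (p / q - 1)\<^sup>2)"
    using assms by (simp add: field_simps power2_eq_square)
  also have "\<dots> \<le> q\<^sup>2 * (2 * (p / q + 2) * (p / q * ln (p / q) - p / q + 1))"
    using x_ln_x_quadratic_bound[of "p / q"] assms False by (intro mult_left_mono) auto
  also have "\<dots> = 2 * (p + 2 * q) * (p * (ln p - ln q) - p + q)"
    unfolding eq using assms by (simp add: field_simps power2_eq_square)
  finally show ?thesis .
qed

text \<open>Cauchy--Schwarz with the weights \<open>p\<^sub>a + 2 q\<^sub>a\<close>, which add up to 3.\<close>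
lemma Pinsker_inequality:
  fixes p q :: "'a \<Rightarrow> real"
  assumes "finite A" and p: "\<And>a. a \<in> A \<Longrightarrow> p a \<ge> 0" "sum p A = 1"
    and q: "\<And>a. a \<in> A \<Longrightarrow> q a \<ge> 0" "sum q A = 1"
    and ac: "\<And>a. a \<in> A \<Longrightarrow> q a = 0 \<Longrightarrow> p a = 0"
  shows "(\<Sum>a\<in>A. \<bar>p a - q a\<bar>)\<^sup>2 / 2 \<le> (\<Sum>a\<in>A. p a * (ln (p a) - ln (q a)))"
proof -
  \<comment> \<open>The correction \<open>- p a + q a\<close> makes each summand nonnegative on its
    own, and it cancels in the sum because both distributions have mass 1.\<close>
  define D where "D = (\<lambda>a. p a * (ln (p a) - ln (q a)) - p a + q a)"
  define c where "c = (\<lambda>a. p a + 2 * q a)"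
  have bound: "\<bar>p a - q a\<bar> \<le> sqrt (c a) * sqrt (2 / 3 * D a)" "D a \<ge> 0" "c a \<ge> 0" if "a \<in> A" for a
  proof -
    have "3 * (p a - q a)\<^sup>2 \<le> 2 * c a * D a \<and> D a \<ge> 0"
    proof (cases "q a = 0")
      case True
      then show ?thesis using ac that by (simp add: D_def c_def)
    next
      case False
      then have pos: "p a \<ge> 0" "q a > 0" using p(1) q(1) that by (auto simp: less_le)
      then have le: "3 * (p a - q a)\<^sup>2 \<le> 2 * c a * D a"
        using ln_divergence_quadratic_bound by (simp add: c_def D_def)
      then have "0 \<le> c a * D a" using zero_le_power2[of "p a - q a"] by linarith
      then show ?thesis using le pos by (auto simp: c_def zero_le_mult_iff)
    qed
    then have le: "(p a - q a)\<^sup>2 \<le> c a * (2 / 3 * D a)" and "D a \<ge> 0" by auto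
    then show "D a \<ge> 0" by simp
    show "c a \<ge> 0" using p(1) q(1) that by (auto simp: c_def)
    show "\<bar>p a - q a\<bar> \<le> sqrt (c a) * sqrt (2 / 3 * D a)"
      using real_sqrt_le_mono[OF le] by (simp only: real_sqrt_mult real_sqrt_abs)
  qed
  have "(\<Sum>a\<in>A. \<bar>p a - q a\<bar>)\<^sup>2 \<le> (\<Sum>a\<in>A. sqrt (c a) * sqrt (2 / 3 * D a))\<^sup>2"
    using bound(1) by (intro power_mono sum_mono sum_nonneg) auto
  also have "\<dots> \<le> (\<Sum>a\<in>A. (sqrt (c a))\<^sup>2) * (\<Sum>a\<in>A. (sqrt (2 / 3 * D a))\<^sup>2)"
    by (rule Cauchy_Schwarz_ineq_sum)
  also have "\<dots> = (\<Sum>a\<in>A. c a) * (\<Sum>a\<in>A. 2 / 3 * D a)"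
    using bound(2,3) by (intro arg_cong2[of _ _ _ _ "(*)"] sum.cong) auto
  also have "(\<Sum>a\<in>A. c a) = 3"
    using p(2) q(2) by (simp add: c_def sum.distrib flip: sum_distrib_left)
  also have "(\<Sum>a\<in>A. 2 / 3 * D a) = 2 / 3 * (\<Sum>a\<in>A. p a * (ln (p a) - ln (q a)))"
    unfolding sum_distrib_left[symmetric] using p(2) q(2) by (simp add: D_def sum.distrib sum_subtractf)
  finally show ?thesis by simp
qed

section \<open>The uniform measures and the law of a pair of vertex variables\<close>

lemma space_unit_interval [simp]: "space unit_interval = {0..1}"
  by (simp add: unit_interval_def space_restrict_space)

lemma space_unit_square [simp]: "space unit_square = {0..1} \<times> {0..1}"
  by (simp add: unit_square_def space_restrict_space)

lemma prob_space_unit_interval: "prob_space unit_interval"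
  by (rule prob_spaceI) (simp add: unit_interval_def space_restrict_space emeasure_restrict_space)

text \<open>The bridge between the product measure on vertex variables and the square on which
  graphons live. A product of sigma-finite measures is determined by its values on measurable
  rectangles, and there both sides agree.\<close>

lemma unit_square_eq_pair_measure: "unit_interval \<Otimes>\<^sub>M unit_interval = unit_square"
proof (rule pair_measure_eqI)
  interpret prob_space unit_interval by (rule prob_space_unit_interval)
  show "sigma_finite_measure unit_interval" "sigma_finite_measure unit_interval"
    by unfold_locales
  have Times: "A \<times> B \<in> sets unit_square"
    if "A \<in> sets unit_interval" "B \<in> sets unit_interval" for A B
    using that
    by (auto simp: unit_interval_def unit_square_def sets_restrict_space_iff borel_Times)
  show "sets (unit_interval \<Otimes>\<^sub>M unit_interval) = sets unit_square"
  proof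
    show "sets (unit_interval \<Otimes>\<^sub>M unit_interval) \<subseteq> sets unit_square"
      using Times by (intro sets_pair_in_sets) (auto simp: space_pair_measure)
    \<comment> \<open>For the converse inclusion, the identity into the plane is measurable
      coordinatewise, so every Borel subset of the square is its own measurable preimage.\<close>
    have id: "(\<lambda>x. x) \<in> unit_interval \<rightarrow>\<^sub>M borel"
      unfolding unit_interval_def by (intro measurable_restrict_space1) simp
    have "(\<lambda>p. (fst p, snd p)) \<in> unit_interval \<Otimes>\<^sub>M unit_interval \<rightarrow>\<^sub>M borel \<Otimes>\<^sub>M borel"
      by (intro measurable_Pair measurable_compose[OF _ id]) simp_all
    then have pair: "(\<lambda>p. p) \<in> unit_interval \<Otimes>\<^sub>M unit_interval \<rightarrow>\<^sub>M borel"
      by (simp add: borel_prod)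
    show "sets unit_square \<subseteq> sets (unit_interval \<Otimes>\<^sub>M unit_interval)"
    proof
      fix A assume "A \<in> sets unit_square"
      then have "A \<in> sets borel" "A \<subseteq> {0..1} \<times> {0..1}"
        by (auto simp: unit_square_def sets_restrict_space_iff borel_Times)
      then show "A \<in> sets (unit_interval \<Otimes>\<^sub>M unit_interval)"
        using measurable_sets[OF pair, of A] by (simp add: space_pair_measure Int_absorb2)
    qed
  qed
  fix A B assume A: "A \<in> sets unit_interval" and B: "B \<in> sets unit_interval"
  then have "A \<in> sets borel" "B \<in> sets borel" "A \<subseteq> {0..1}" "B \<subseteq> {0..1}"
    by (auto simp: unit_interval_def sets_restrict_space_iff)
  moreover from this have "A \<times> B \<subseteq> {0..1} \<times> {0..1}" by auto
  ultimately show "emeasure unit_interval A * emeasure unit_interval B = emeasure unit_square (A \<times> B)"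
    by (simp add: unit_interval_def unit_square_def emeasure_restrict_space borel_Times
        lborel.emeasure_pair_measure_Times flip: lborel_prod)
qed

lemma prob_space_unit_square: "prob_space unit_square"
proof -
  interpret prob_space unit_interval by (rule prob_space_unit_interval)
  interpret pair_prob_space unit_interval unit_interval ..
  show ?thesis by (rule prob_space_axioms[unfolded unit_square_eq_pair_measure])
qed

interpretation unit_square: prob_space unit_square
  by (rule prob_space_unit_square)

lemma measure_unit_square [simp]: "measure unit_square ({0..1} \<times> {0..1}) = 1"
  using unit_square.prob_space by simp

lemma measurable_vertex_pair:
  assumes "u \<in> V" "v \<in> V"
  shows "(\<lambda>x. (x u, x v)) \<in> PiM V (\<lambda>_. unit_interval) \<rightarrow>\<^sub>M unit_square"
  unfolding unit_square_eq_pair_measure[symmetric] using assms by simp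

text \<open>Two distinct coordinates are independent and uniform: the preimage of a rectangle is a
  cylinder over \<open>{u, v}\<close>, whose measure is the product of the two side
  measures.\<close>

lemma distr_vertex_pair:
  assumes "u \<in> V" "v \<in> V" "u \<noteq> v"
  shows "distr (PiM V (\<lambda>_. unit_interval)) unit_square (\<lambda>x. (x u, x v)) = unit_square"
    (is "?D = _")
proof -
  interpret prob_space unit_interval by (rule prob_space_unit_interval)
  have "unit_interval \<Otimes>\<^sub>M unit_interval = ?D"
  proof (rule pair_measure_eqI)
    show "sigma_finite_measure unit_interval" "sigma_finite_measure unit_interval"
      by unfold_locales
    show "sets (unit_interval \<Otimes>\<^sub>M unit_interval) = sets ?D"
      unfolding sets_distr unit_square_eq_pair_measure ..
    fix A B assume AB: "A \<in> sets unit_interval" "B \<in> sets unit_interval"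
    define X where "X = (\<lambda>i. if i = u then A else B)"
    have "A \<times> B \<in> sets unit_square"
      using AB unfolding unit_square_eq_pair_measure[symmetric] by simp
    then have "emeasure ?D (A \<times> B) = emeasure (PiM V (\<lambda>_. unit_interval))
        ((\<lambda>x. (x u, x v)) -` (A \<times> B) \<inter> space (PiM V (\<lambda>_. unit_interval)))"
      by (intro emeasure_distr measurable_vertex_pair assms)
    also have "(\<lambda>x. (x u, x v)) -` (A \<times> B) \<inter> space (PiM V (\<lambda>_. unit_interval))
        = prod_emb V (\<lambda>_. unit_interval) {u, v} (Pi\<^sub>E {u, v} X)"
      using assms by (auto simp: prod_emb_def space_PiM X_def PiE_iff)
    also have "emeasure (PiM V (\<lambda>_. unit_interval)) \<dots> = (\<Prod>i\<in>{u, v}. emeasure unit_interval (X i))"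
      using assms AB prob_space_unit_interval by (intro emeasure_PiM_emb) (auto simp: X_def)
    also have "\<dots> = emeasure unit_interval A * emeasure unit_interval B"
      using assms by (simp add: X_def)
    finally show "emeasure unit_interval A * emeasure unit_interval B = emeasure ?D (A \<times> B)" by simp
  qed
  then show ?thesis by (simp add: unit_square_eq_pair_measure)
qed

section \<open>Integrability for graphons and the edge marginals\<close>

lemma color_simplexD:
  assumes "\<mu> \<in> color_simplex"
  shows "0 \<le> \<mu> $ a" "\<mu> $ a \<le> 1" "(\<Sum>a\<in>UNIV. \<mu> $ a) = 1"
  using assms by (auto simp: color_simplex_def)

lemma prob_graphon_color_simplex:
  assumes "W \<in> prob_graphons" "p \<in> space unit_square"
  shows "W p \<in> color_simplex"
  using assms by (auto simp: prob_graphons_def)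

lemma const_prob_graphon: "\<mu> \<in> color_simplex \<Longrightarrow> (\<lambda>_. \<mu>) \<in> prob_graphons"
  by (simp add: prob_graphons_def)

lemma integrable_prob_graphon:
  fixes f :: "real ^ 'k::finite \<Rightarrow> real"
  assumes W: "W \<in> prob_graphons" and f: "f \<in> borel_measurable borel"
    and bound: "\<And>\<mu>. \<mu> \<in> color_simplex \<Longrightarrow> \<bar>f \<mu>\<bar> \<le> B"
  shows "integrable unit_square (\<lambda>p. f (W p))"
proof (rule unit_square.integrable_const_bound[where B = B])
  show "AE p in unit_square. norm (f (W p)) \<le> B"
    using bound prob_graphon_color_simplex[OF W] by (intro AE_I2) auto
  show "(\<lambda>p. f (W p)) \<in> borel_measurable unit_square"
    by (rule measurable_compose[OF _ f]) (use W in \<open>simp add: prob_graphons_def\<close>)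
qed

abbreviation edge_point :: "('v \<Rightarrow> real) \<Rightarrow> 'v set \<Rightarrow> real \<times> real" where
  "edge_point x e \<equiv> (case edge_ends e of (u, v) \<Rightarrow> (x u, x v))"

lemma edge_weight_eq: "edge_weight W a x e = W (edge_point x e) $ a"
  by (simp add: edge_weight_def split: prod.split)

lemma edge_ends_cases:
  assumes "finite_simple_cgraph G" "e \<in> edges G"
  obtains u v where "edge_ends e = (u, v)" "u \<in> verts G" "v \<in> verts G" "u \<noteq> v"
proof -
  obtain u v where e: "e = {u, v}" "u \<noteq> v"
    using assms by (auto simp: finite_simple_cgraph_def card_2_iff)
  have "case edge_ends e of (p, q) \<Rightarrow> e = {p, q}"
    unfolding edge_ends_def by (rule someI[where x = "(u, v)"]) (simp add: e)
  then obtain p q where pq: "edge_ends e = (p, q)" "e = {p, q}" by (cases "edge_ends e") auto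
  moreover have "e \<subseteq> verts G" "p \<noteq> q"
    using assms e pq by (auto simp: finite_simple_cgraph_def)
  ultimately show ?thesis using that by auto
qed

lemma finite_edges: "finite_simple_cgraph G \<Longrightarrow> finite (edges G)"
  unfolding finite_simple_cgraph_def by (auto intro: finite_subset[of _ "Pow (verts G)"])

lemma
  assumes G: "finite_simple_cgraph G" and e: "e \<in> edges G"
  shows measurable_edge_point:
      "(\<lambda>x. edge_point x e) \<in> PiM (verts G) (\<lambda>_. unit_interval) \<rightarrow>\<^sub>M unit_square"
    and distr_edge_point:
      "distr (PiM (verts G) (\<lambda>_. unit_interval)) unit_square (\<lambda>x. edge_point x e) = unit_square"
proof -
  obtain u v where *: "edge_ends e = (u, v)" "u \<in> verts G" "v \<in> verts G" "u \<noteq> v"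
    by (rule edge_ends_cases[OF G e])
  show "(\<lambda>x. edge_point x e) \<in> PiM (verts G) (\<lambda>_. unit_interval) \<rightarrow>\<^sub>M unit_square"
    unfolding *(1) prod.case by (rule measurable_vertex_pair[OF *(2,3)])
  show "distr (PiM (verts G) (\<lambda>_. unit_interval)) unit_square (\<lambda>x. edge_point x e) = unit_square"
    unfolding *(1) prod.case by (rule distr_vertex_pair[OF *(2-4)])
qed

text \<open>Change of variables along the edge map. Whatever the graph and the edge, a function of
  the graphon at a single edge integrates as it does over the square.\<close>

lemma
  fixes f :: "real ^ 'k::finite \<Rightarrow> real"
  assumes G: "finite_simple_cgraph G" and e: "e \<in> edges G"
    and W: "W \<in> prob_graphons" and f: "f \<in> borel_measurable borel"
    and bound: "\<And>\<mu>. \<mu> \<in> color_simplex \<Longrightarrow> \<bar>f \<mu>\<bar> \<le> B"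
  shows integrable_edge:
      "integrable (PiM (verts G) (\<lambda>_. unit_interval)) (\<lambda>x. f (W (edge_point x e)))"
    and integral_edge:
      "(LINT x | PiM (verts G) (\<lambda>_. unit_interval). f (W (edge_point x e)))
        = (LINT p | unit_square. f (W p))"
proof -
  have int: "integrable unit_square (\<lambda>p. f (W p))"
    using W f bound by (rule integrable_prob_graphon)
  show "integrable (PiM (verts G) (\<lambda>_. unit_interval)) (\<lambda>x. f (W (edge_point x e)))"
    using int by (intro integrable_distr[OF measurable_edge_point[OF G e]])
      (simp only: distr_edge_point[OF G e])
  show "(LINT x | PiM (verts G) (\<lambda>_. unit_interval). f (W (edge_point x e)))
        = (LINT p | unit_square. f (W p))"
    using integral_distr[OF measurable_edge_point[OF G e] borel_measurable_integrable[OF int]]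
    by (simp only: distr_edge_point[OF G e])
qed

section \<open>First-order expansion of the densities around a constant\<close>

lemma color_simplex_nth_bounds:
  assumes "\<mu> \<in> color_simplex" "q \<in> color_simplex"
  shows "\<bar>\<mu> $ a\<bar> \<le> 1" "\<bar>(\<mu> $ a - q $ a)\<^sup>2\<bar> \<le> 1"
proof -
  note * = color_simplexD(1,2)[OF assms(1), of a] color_simplexD(1,2)[OF assms(2), of a]
  show "\<bar>\<mu> $ a\<bar> \<le> 1" using * by auto
  have "\<bar>\<mu> $ a - q $ a\<bar> \<le> 1" using * by (auto simp: abs_le_iff)
  then show "\<bar>(\<mu> $ a - q $ a)\<^sup>2\<bar> \<le> 1" by (simp add: abs_square_le_1)
qed

text \<open>\<open>prod_first_order_remainder\<close> holds at each point \<open>x\<close> with the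
  edge weights as factors. After integration, the linear and the quadratic terms each involve one
  edge only, so the uniform edge marginals turn them into integrals over the square.\<close>

lemma hom_density_first_order:
  assumes G: "finite_simple_cgraph G" and W: "W \<in> prob_graphons" and q: "q \<in> color_simplex"
  shows "\<bar>hom_density G W - (\<Prod>e\<in>edges G. q $ color G e)
      - (\<Sum>e\<in>edges G. ((LINT p | unit_square. W p $ color G e) - q $ color G e)
           * (\<Prod>f\<in>edges G - {e}. q $ color G f))\<bar>
    \<le> (real (card (edges G)) - 1) / 2
        * (\<Sum>e\<in>edges G. LINT p | unit_square. (W p $ color G e - q $ color G e)\<^sup>2)"
proof -
  define P where "P = PiM (verts G) (\<lambda>_. unit_interval)"
  interpret P: prob_space P
    unfolding P_def by (intro prob_space_PiM prob_space_unit_interval)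
  define w where "w = (\<lambda>x e. W (edge_point x e) $ color G e)"
  define c where "c = (\<lambda>e. q $ color G e)"
  define Q where "Q = (\<lambda>e. \<Prod>f\<in>edges G - {e}. c f)"
  define F where "F = (\<lambda>x. prod (w x) (edges G) - prod c (edges G) - (\<Sum>e\<in>edges G. (w x e - c e) * Q e))"
  define B where "B = (\<lambda>x. (real (card (edges G)) - 1) / 2 * (\<Sum>e\<in>edges G. (w x e - c e)\<^sup>2))"
  have w: "w x e \<in> {0..1}" if "x \<in> space P" "e \<in> edges G" for x e
    using measurable_space[OF measurable_edge_point[OF G that(2)], of x]
      prob_graphon_color_simplex[OF W] that
    unfolding w_def P_def by (simp add: color_simplexD)
  have c: "c e \<in> {0..1}" for e
    using q by (simp add: c_def color_simplexD)
  have int_w: "integrable P (\<lambda>x. w x e)" "P.expectation (\<lambda>x. w x e) = (LINT p | unit_square. W p $ color G e)"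
    and int_sq: "integrable P (\<lambda>x. (w x e - c e)\<^sup>2)"
      "P.expectation (\<lambda>x. (w x e - c e)\<^sup>2) = (LINT p | unit_square. (W p $ color G e - q $ color G e)\<^sup>2)"
    if "e \<in> edges G" for e
    using integrable_edge[OF G that W, where f = "\<lambda>\<mu>. \<mu> $ color G e" and B = 1]
      integral_edge[OF G that W, where f = "\<lambda>\<mu>. \<mu> $ color G e" and B = 1]
      integrable_edge[OF G that W, where f = "\<lambda>\<mu>. (\<mu> $ color G e - q $ color G e)\<^sup>2" and B = 1]
      integral_edge[OF G that W, where f = "\<lambda>\<mu>. (\<mu> $ color G e - q $ color G e)\<^sup>2" and B = 1]
      color_simplex_nth_bounds[OF _ q]
    by (simp_all add: P_def w_def c_def)
  have meas: "(\<lambda>x. w x e) \<in> borel_measurable P" if "e \<in> edges G" for e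
    using int_w(1)[OF that] by (rule borel_measurable_integrable)
  have int_prod: "integrable P (\<lambda>x. prod (w x) (edges G))"
  proof (rule P.integrable_const_bound[where B = 1])
    show "AE x in P. norm (prod (w x) (edges G)) \<le> 1"
      using w by (intro AE_I2) (auto simp: abs_prod intro!: prod_le_1)
  qed (use meas in measurable)
  have int_F: "integrable P F" and int_B: "integrable P B"
    unfolding F_def B_def using int_prod int_w(1) int_sq(1) by auto
  have "hom_density G W = P.expectation (\<lambda>x. prod (w x) (edges G))"
    by (simp add: hom_density_def edge_weight_eq P_def w_def)
  then have F: "P.expectation F = hom_density G W - prod c (edges G)
      - (\<Sum>e\<in>edges G. ((LINT p | unit_square. W p $ color G e) - c e) * Q e)"
    unfolding F_def using int_prod int_w
    by (simp add: P.prob_space)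
  have "\<bar>P.expectation F\<bar> \<le> P.expectation (\<lambda>x. \<bar>F x\<bar>)"
    by (rule integral_abs_bound)
  also have "\<dots> \<le> P.expectation B"
    using int_F int_B prod_first_order_remainder[OF finite_edges[OF G]] w c
    by (intro integral_mono) (auto simp: F_def B_def Q_def)
  also have "\<dots> = (real (card (edges G)) - 1) / 2
        * (\<Sum>e\<in>edges G. LINT p | unit_square. (W p $ color G e - q $ color G e)\<^sup>2)"
    unfolding B_def using int_sq by simp
  finally show ?thesis unfolding F by (simp add: c_def Q_def)
qed

definition sq_l1_dist :: "(real \<times> real \<Rightarrow> real ^ 'k::finite) \<Rightarrow> real ^ 'k \<Rightarrow> real" where
  "sq_l1_dist W q = (LINT p | unit_square. (\<Sum>a\<in>UNIV. \<bar>W p $ a - q $ a\<bar>)\<^sup>2)"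

lemma integrable_sq_l1:
  assumes "W \<in> prob_graphons" "q \<in> color_simplex"
  shows "integrable unit_square (\<lambda>p. (\<Sum>a\<in>UNIV. \<bar>W p $ a - q $ a\<bar>)\<^sup>2)"
proof (rule integrable_prob_graphon[OF assms(1), where B = 4])
  fix \<mu> :: "real ^ 'a" assume \<mu>: "\<mu> \<in> color_simplex"
  \<comment> \<open>The bound 4 is the square of 2, the combined mass of two probability
    vectors.\<close>
  have "(\<Sum>a\<in>UNIV. \<bar>\<mu> $ a - q $ a\<bar>) \<le> (\<Sum>a\<in>UNIV. \<mu> $ a + q $ a)"
  proof (rule sum_mono)
    fix a show "\<bar>\<mu> $ a - q $ a\<bar> \<le> \<mu> $ a + q $ a"
      using color_simplexD(1)[OF \<mu>, of a] color_simplexD(1)[OF assms(2), of a] by linarith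
  qed
  also have "\<dots> = 2"
    using \<mu> assms(2) by (simp add: sum.distrib color_simplexD)
  finally have "(\<Sum>a\<in>UNIV. \<bar>\<mu> $ a - q $ a\<bar>)\<^sup>2 \<le> 2\<^sup>2"
    by (intro power_mono sum_nonneg) auto
  then show "\<bar>(\<Sum>a\<in>UNIV. \<bar>\<mu> $ a - q $ a\<bar>)\<^sup>2\<bar> \<le> 4" by simp
qed measurable

text \<open>Grouping the edges by color turns the color counts into the weights \<open>n\<close>. At
  each point the coordinates of \<open>W p - q\<close> sum to zero, so
  \<open>weighted_sum_squares_le\<close> applies under the integral.\<close>

lemma sum_edges_sq_le:
  fixes G :: "('v, 'k::finite) cgraph"
  assumes k: "CARD('k) \<ge> 2" and G: "finite_simple_cgraph G"
    and W: "W \<in> prob_graphons" and q: "q \<in> color_simplex"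
  shows "(\<Sum>e\<in>edges G. LINT p | unit_square. (W p $ color G e - q $ color G e)\<^sup>2)
    \<le> real (Max {card (edges_of_color G a) + card (edges_of_color G b) | a b. a \<noteq> b}) / 4
        * sq_l1_dist W q"
    (is "_ \<le> real (Max ?S) / 4 * _")
proof -
  define n where "n = (\<lambda>a. real (card (edges_of_color G a)))"
  define I where "I = (\<lambda>a. LINT p | unit_square. (W p $ a - q $ a)\<^sup>2)"
  have int: "integrable unit_square (\<lambda>p. (W p $ a - q $ a)\<^sup>2)" for a
    by (rule integrable_prob_graphon[OF W _ color_simplex_nth_bounds(2)[OF _ q]]) measurable
  have "(\<Sum>e\<in>edges G. I (color G e)) = (\<Sum>a\<in>UNIV. \<Sum>e | e \<in> edges G \<and> color G e = a. I (color G e))"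
    by (subst sum.group) (auto simp: finite_edges G)
  also have "\<dots> = (\<Sum>a\<in>UNIV. n a * I a)"
    by (simp add: n_def edges_of_color_def)
  also have "\<dots> = (LINT p | unit_square. (\<Sum>a\<in>UNIV. n a * (W p $ a - q $ a)\<^sup>2))"
    using int by (simp add: I_def)
  also have "\<dots> \<le> (LINT p | unit_square. real (Max ?S) / 4 * (\<Sum>a\<in>UNIV. \<bar>W p $ a - q $ a\<bar>)\<^sup>2)"
  proof (rule integral_mono)
    show "integrable unit_square (\<lambda>p. \<Sum>a\<in>UNIV. n a * (W p $ a - q $ a)\<^sup>2)"
      "integrable unit_square (\<lambda>p. real (Max ?S) / 4 * (\<Sum>a\<in>UNIV. \<bar>W p $ a - q $ a\<bar>)\<^sup>2)"
      using int integrable_sq_l1[OF W q] by auto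
    have "finite ?S"
      by (rule finite_subset[of _ "(\<lambda>(a, b). card (edges_of_color G a) + card (edges_of_color G b)) ` UNIV"]) auto
    then have max: "n a + n b \<le> real (Max ?S)" if "a \<noteq> b" for a b
      unfolding n_def of_nat_add[symmetric] of_nat_le_iff using that by (intro Max_ge) auto
    fix p assume "p \<in> space unit_square"
    then have "(\<Sum>a\<in>UNIV. W p $ a - q $ a) = 0"
      using prob_graphon_color_simplex[OF W] q by (simp add: sum_subtractf color_simplexD)
    then show "(\<Sum>a\<in>UNIV. n a * (W p $ a - q $ a)\<^sup>2)
        \<le> real (Max ?S) / 4 * (\<Sum>a\<in>UNIV. \<bar>W p $ a - q $ a\<bar>)\<^sup>2"
      using max by (intro weighted_sum_squares_le k) (auto simp: n_def)
  qed
  finally show ?thesis by (simp add: I_def sq_l1_dist_def)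
qed

text \<open>The 8 is the product of the 2 from the product remainder and the 4 from
  \<open>sum_edges_sq_le\<close>. The expansion is two-sided, so coefficients
  \<open>\<beta> s\<close> of either sign are handled through their absolute values.\<close>

lemma density_combination_first_order:
  fixes H :: "nat \<Rightarrow> ('v, 'k::finite) cgraph"
  assumes k: "CARD('k) \<ge> 2" and H: "\<forall>s\<in>{1..r}. finite_simple_cgraph (H s)"
    and W: "W \<in> prob_graphons" and q: "q \<in> color_simplex"
  shows "density_combination r \<beta> H W
    \<le> (\<Sum>s=1..r. \<beta> s * (\<Prod>e\<in>edges (H s). q $ color (H s) e))
      + (\<Sum>s=1..r. \<beta> s * (\<Sum>e\<in>edges (H s).
          ((LINT p | unit_square. W p $ color (H s) e) - q $ color (H s) e)
            * (\<Prod>f\<in>edges (H s) - {e}. q $ color (H s) f)))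
      + Lambda_const r \<beta> H / 8 * sq_l1_dist W q"
proof -
  define M where "M = (\<lambda>s. real (Max {card (edges_of_color (H s) a) + card (edges_of_color (H s) b) | a b. a \<noteq> b}))"
  define A where "A = (\<lambda>s. \<Prod>e\<in>edges (H s). q $ color (H s) e)"
  define L where "L = (\<lambda>s. \<Sum>e\<in>edges (H s).
          ((LINT p | unit_square. W p $ color (H s) e) - q $ color (H s) e)
            * (\<Prod>f\<in>edges (H s) - {e}. q $ color (H s) f))"
  have "\<beta> s * hom_density (H s) W \<le> \<beta> s * A s + \<beta> s * L s
      + \<bar>\<beta> s\<bar> * (real (card (edges (H s))) - 1) * M s / 8 * sq_l1_dist W q"
    if s: "s \<in> {1..r}" for s
  proof -
    have Hs: "finite_simple_cgraph (H s)" using H s by blast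
    have 1: "\<bar>hom_density (H s) W - A s - L s\<bar> \<le> (real (card (edges (H s))) - 1) / 2
        * (\<Sum>e\<in>edges (H s). LINT p | unit_square. (W p $ color (H s) e - q $ color (H s) e)\<^sup>2)"
      (is "_ \<le> _ * ?I")
      unfolding A_def L_def by (rule hom_density_first_order[OF Hs W q])
    have 2: "\<dots> \<le> (real (card (edges (H s))) - 1) * M s / 8 * sq_l1_dist W q"
    \<comment> \<open>Without edges the factor \<open>card (edges (H s)) - 1\<close> is
      \<open>-1\<close>, and multiplying by it would reverse the inequality. In that case all color
      counts are 0; since two distinct colors exist, the maximum is taken over a nonempty set and
      equals 0, so both sides vanish.\<close>
    proof (cases "edges (H s) = {}")
      case True
      then have "edges_of_color (H s) a = {}" for a by (simp add: edges_of_color_def)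
      moreover obtain a b :: 'k where "a \<noteq> b"
        using k by (metis UNIV_I card_2_iff' card_le_Suc0_iff_eq finite not_less_eq_eq numeral_2_eq_2)
      then have "\<exists>a b :: 'k. a \<noteq> b" by blast
      ultimately have "M s = 0" by (auto simp: M_def)
      then show ?thesis using True by simp
    next
      case False
      then have "real (card (edges (H s))) - 1 \<ge> 0"
        using finite_edges[OF Hs] by (simp add: Suc_le_eq card_gt_0_iff)
      from mult_left_mono[OF sum_edges_sq_le[OF k Hs W q] this]
      show ?thesis by (simp add: M_def)
    qed
    have "\<beta> s * (hom_density (H s) W - A s - L s) \<le> \<bar>\<beta> s\<bar> * \<bar>hom_density (H s) W - A s - L s\<bar>"
      by (metis abs_ge_self abs_mult)
    also have "\<dots> \<le> \<bar>\<beta> s\<bar> * ((real (card (edges (H s))) - 1) * M s / 8 * sq_l1_dist W q)"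
      using 1 2 by (intro mult_left_mono) auto
    finally have "\<beta> s * hom_density (H s) W - \<beta> s * A s - \<beta> s * L s
        \<le> \<bar>\<beta> s\<bar> * ((real (card (edges (H s))) - 1) * M s / 8 * sq_l1_dist W q)"
      unfolding right_diff_distrib .
    then show ?thesis by (simp add: mult.assoc)
  qed
  then have "density_combination r \<beta> H W \<le> (\<Sum>s=1..r. \<beta> s * A s + \<beta> s * L s
      + \<bar>\<beta> s\<bar> * (real (card (edges (H s))) - 1) * M s / 8 * sq_l1_dist W q)"
    unfolding density_combination_def by (rule sum_mono)
  then show ?thesis
    by (simp add: sum.distrib Lambda_const_def M_def A_def L_def sum_distrib_right sum_divide_distrib)
qed

section \<open>Entropy, compactness of the simplex and the integrated Pinsker inequality\<close>

lemma continuous_on_x_ln_x: "continuous_on {0..} (\<lambda>x::real. x * ln x)"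
proof (rule continuous_on_eq_continuous_within[THEN iffD2], rule ballI)
  fix x :: real assume "x \<in> {0..}"
  show "continuous (at x within {0..}) (\<lambda>x. x * ln x)"
  proof (cases "x = 0")
    case True
    \<comment> \<open>The one-sided limit matches the value \<open>0 * ln 0 = 0\<close> at the
      endpoint.\<close>
    have "((\<lambda>x::real. x * ln x) \<longlongrightarrow> 0) (at_right 0)" by real_asymp
    then show ?thesis using True
      by (simp add: continuous_within at_within_Ici_at_right)
  next
    case False
    then show ?thesis using \<open>x \<in> {0..}\<close> by (auto intro!: continuous_intros)
  qed
qed

lemma compact_color_simplex: "compact (color_simplex :: (real ^ 'k::finite) set)"
proof (rule compact_eq_bounded_closed[THEN iffD2], rule conjI)
  show "bounded (color_simplex :: (real ^ 'k) set)"
  proof (rule boundedI)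
    fix \<mu> :: "real ^ 'k" assume \<mu>: "\<mu> \<in> color_simplex"
    have "norm \<mu> \<le> (\<Sum>a\<in>UNIV. \<bar>\<mu> $ a\<bar>)" by (rule norm_le_l1_cart)
    then show "norm \<mu> \<le> 1" using color_simplexD[OF \<mu>] by simp
  qed
  have "color_simplex = (\<Inter>a. {\<mu>::real^'k. 0 \<le> \<mu> $ a} \<inter> {\<mu>. \<mu> $ a \<le> 1}) \<inter> {\<mu>. (\<Sum>a\<in>UNIV. \<mu> $ a) = 1}"
    by (auto simp: color_simplex_def)
  then show "closed (color_simplex :: (real ^ 'k) set)"
    by (rule ssubst) (intro closed_Int closed_INT ballI closed_Collect_le closed_Collect_eq continuous_intros)
qed

lemma abs_x_ln_x_le_1:
  fixes x :: real
  assumes "0 \<le> x" "x \<le> 1"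
  shows "\<bar>x * ln x\<bar> \<le> 1"
proof (cases "x = 0")
  case False
  then have "x > 0" using assms by simp
  moreover have "- ln x \<le> inverse x - 1"
    using ln_le_minus_one[of "inverse x"] \<open>x > 0\<close> by (simp add: ln_inverse)
  ultimately have "x * (- ln x) \<le> x * (inverse x - 1)" by (intro mult_left_mono) auto
  also have "\<dots> \<le> 1" using \<open>x > 0\<close> by (simp add: algebra_simps)
  finally have "- (x * ln x) \<le> 1" by simp
  moreover have "x * ln x \<le> 0" using assms \<open>x > 0\<close> by (simp add: mult_nonneg_nonpos)
  ultimately show ?thesis by simp
qed simp

lemma integrable_prob_graphon_nth: "W \<in> prob_graphons \<Longrightarrow> integrable unit_square (\<lambda>p. W p $ a)"
  by (rule integrable_prob_graphon[where B = 1]) (auto simp: color_simplexD abs_of_nonneg)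

lemma integrable_entropy:
  assumes W: "W \<in> prob_graphons"
  shows "integrable unit_square (\<lambda>p. W p $ a * ln (W p $ a))"
  by (rule integrable_prob_graphon[OF W, where B = 1])
    (auto intro!: abs_x_ln_x_le_1 simp: color_simplexD)

text \<open>Pinsker's inequality between \<open>W p\<close> and \<open>q\<close>, integrated over
  the square. The cross term is linear in \<open>W\<close>, hence depends only on its mean. Since
  \<open>ln 0\<close> is an ordinary real, absolute continuity has to be stated explicitly as
  \<open>ac\<close>; no infinite relative entropy takes its place.\<close>

lemma entropy_functional_ge:
  assumes W: "W \<in> prob_graphons" and q: "q \<in> color_simplex"
    and ac: "\<And>a. q $ a = 0 \<Longrightarrow> AE p in unit_square. W p $ a = 0"
  shows "(\<Sum>a\<in>UNIV. (LINT p | unit_square. W p $ a) * ln (q $ a)) + sq_l1_dist W q / 2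
    \<le> entropy_functional W"
proof -
  have "(\<Sum>a\<in>UNIV. (LINT p | unit_square. W p $ a) * ln (q $ a)) + sq_l1_dist W q / 2
     = (LINT p | unit_square. (\<Sum>a\<in>UNIV. W p $ a * ln (q $ a)) + (\<Sum>a\<in>UNIV. \<bar>W p $ a - q $ a\<bar>)\<^sup>2 / 2)"
    using integrable_prob_graphon_nth[OF W] integrable_sq_l1[OF W q] by (simp add: sq_l1_dist_def)
  also have "\<dots> \<le> (LINT p | unit_square. (\<Sum>a\<in>UNIV. W p $ a * ln (W p $ a)))"
  proof (rule integral_mono_AE)
    have "AE p in unit_square. \<forall>a\<in>UNIV. q $ a = 0 \<longrightarrow> W p $ a = 0"
      using ac by (intro AE_finite_allI) auto
    moreover have "AE p in unit_square. W p \<in> color_simplex"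
      using prob_graphon_color_simplex[OF W] by (rule AE_I2)
    ultimately show "AE p in unit_square.
        (\<Sum>a\<in>UNIV. W p $ a * ln (q $ a)) + (\<Sum>a\<in>UNIV. \<bar>W p $ a - q $ a\<bar>)\<^sup>2 / 2
          \<le> (\<Sum>a\<in>UNIV. W p $ a * ln (W p $ a))"
    proof eventually_elim
      case (elim p)
      then show ?case
        using Pinsker_inequality[of UNIV "\<lambda>a. W p $ a" "\<lambda>a. q $ a"] q
        by (simp add: color_simplexD right_diff_distrib sum_subtractf)
    qed
  qed (use integrable_prob_graphon_nth[OF W] integrable_sq_l1[OF W q] integrable_entropy[OF W] in auto)
  also have "\<dots> = entropy_functional W"
    using integrable_entropy[OF W] by (simp add: entropy_functional_def)
  finally show ?thesis .
qed

section \<open>Constant graphons, the mean, and the distance to a constant\<close>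

lemma hom_density_const:
  assumes "finite_simple_cgraph G"
  shows "hom_density G (\<lambda>_. q) = (\<Prod>e\<in>edges G. q $ color G e)"
proof -
  interpret prob_space "PiM (verts G) (\<lambda>_. unit_interval)"
    by (intro prob_space_PiM prob_space_unit_interval)
  show ?thesis by (simp add: hom_density_def edge_weight_eq prob_space)
qed

lemma density_combination_const:
  assumes "\<forall>s\<in>{1..r}. finite_simple_cgraph (H s)"
  shows "density_combination r \<beta> H (\<lambda>_. q) = (\<Sum>s=1..r. \<beta> s * (\<Prod>e\<in>edges (H s). q $ color (H s) e))"
  unfolding density_combination_def using assms by (intro sum.cong) (auto simp: hom_density_const)

lemma entropy_functional_const: "entropy_functional (\<lambda>_. q) = (\<Sum>a\<in>UNIV. q $ a * ln (q $ a))"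
  by (simp add: entropy_functional_def)

definition mean :: "(real \<times> real \<Rightarrow> real ^ 'k::finite) \<Rightarrow> real ^ 'k" where
  "mean W = (\<chi> a. LINT p | unit_square. W p $ a)"

lemma mean_const: "mean (\<lambda>_. q) = q"
  by (simp add: mean_def vec_eq_iff)

lemma mean_color_simplex:
  assumes W: "W \<in> prob_graphons"
  shows "mean W \<in> color_simplex"
proof -
  note simplex = color_simplexD[OF prob_graphon_color_simplex[OF W]]
  note int = integrable_prob_graphon_nth[OF W]
  have "0 \<le> mean W $ a" "mean W $ a \<le> 1" for a
    using simplex int by (auto simp: mean_def intro!: integral_nonneg_AE AE_I2 unit_square.integral_le_const)
  moreover have "(\<Sum>a\<in>UNIV. mean W $ a) = (LINT p | unit_square. (\<Sum>a\<in>UNIV. W p $ a))"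
    using int by (simp add: mean_def)
  moreover have "\<dots> = (LINT p | unit_square. 1)"
    using simplex(3) by (intro Bochner_Integration.integral_cong) auto
  ultimately show ?thesis
    by (simp add: color_simplex_def)
qed

text \<open>A nonnegative function with integral 0 vanishes almost everywhere. This supplies the
  absolute continuity needed for comparing a graphon with its own mean.\<close>

lemma mean_nth_eq_0:
  assumes W: "W \<in> prob_graphons" and "mean W $ a = 0"
  shows "AE p in unit_square. W p $ a = 0"
proof (rule integral_nonneg_eq_0_iff_AE[THEN iffD1])
  show "integrable unit_square (\<lambda>p. W p $ a)" by (rule integrable_prob_graphon_nth[OF W])
  show "AE p in unit_square. 0 \<le> W p $ a"
    using color_simplexD(1)[OF prob_graphon_color_simplex[OF W]] by (rule AE_I2)
  show "(LINT p | unit_square. W p $ a) = 0" using assms by (simp add: mean_def)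
qed

lemma sq_l1_dist_nonneg: "0 \<le> sq_l1_dist W q"
  by (simp add: sq_l1_dist_def)

lemma sq_l1_dist_eq_0:
  assumes W: "W \<in> prob_graphons" and q: "q \<in> color_simplex" and "sq_l1_dist W q = 0"
  shows "AE p in unit_square. W p = q"
proof -
  have "AE p in unit_square. (\<Sum>a\<in>UNIV. \<bar>W p $ a - q $ a\<bar>)\<^sup>2 = 0"
    using assms(3) integrable_sq_l1[OF W q]
    by (subst integral_nonneg_eq_0_iff_AE[symmetric]) (auto simp: sq_l1_dist_def)
  then show ?thesis
    by eventually_elim (simp add: sum_nonneg_eq_0_iff vec_eq_iff)
qed

lemma sq_l1_dist_const_eq_0:
  assumes "sq_l1_dist (\<lambda>_. \<mu>) q = 0"
  shows "\<mu> = q"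
  using assms by (simp add: sq_l1_dist_def sum_nonneg_eq_0_iff vec_eq_iff)

section \<open>The tangent upper bound\<close>

text \<open>At a \<open>q\<close> with positive coordinates this is the directional derivative of
  \<open>J\<close> restricted to constants, along directions \<open>u\<close> with coordinate sum 0:
  the \<open>+ 1\<close> in the derivative of \<open>x * ln x\<close> then cancels. The formula is
  linear in \<open>u\<close> for every \<open>q\<close>.\<close>

definition gradient_term ::
  "nat \<Rightarrow> (nat \<Rightarrow> real) \<Rightarrow> (nat \<Rightarrow> ('v, 'k::finite) cgraph) \<Rightarrow> real ^ 'k \<Rightarrow> real ^ 'k \<Rightarrow> real" where
  "gradient_term r \<beta> H q u =
    (\<Sum>s=1..r. \<beta> s * (\<Sum>e\<in>edges (H s). u $ color (H s) e
       * (\<Prod>f\<in>edges (H s) - {e}. q $ color (H s) f)))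
    - 1/2 * (\<Sum>a\<in>UNIV. u $ a * ln (q $ a))"

lemma gradient_term_0: "gradient_term r \<beta> H q 0 = 0"
  by (simp add: gradient_term_def)

lemma gradient_term_add:
  "gradient_term r \<beta> H q (u + v) = gradient_term r \<beta> H q u + gradient_term r \<beta> H q v"
  by (simp add: gradient_term_def sum.distrib distrib_left distrib_right)

text \<open>The densities gain at most \<open>Lambda_const r \<beta> H / 8\<close> times the
  distance beyond first order, while half of the entropy costs half of Pinsker's \<open>1/2\<close>,
  that is \<open>1/4\<close>. The bracket is positive exactly when the constant is below 2.\<close>

lemma tangent_upper_bound:
  fixes \<beta> :: "nat \<Rightarrow> real" and H :: "nat \<Rightarrow> ('v, 'k::finite) cgraph"
  assumes k: "CARD('k) \<ge> 2" and H: "\<forall>s\<in>{1..r}. finite_simple_cgraph (H s)"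
    and W: "W \<in> prob_graphons" and q: "q \<in> color_simplex"
    and ac: "\<And>a. q $ a = 0 \<Longrightarrow> AE p in unit_square. W p $ a = 0"
  defines "J \<equiv> \<lambda>W. density_combination r \<beta> H W - 1/2 * entropy_functional W"
  shows "J W \<le> J (\<lambda>_. q) + gradient_term r \<beta> H q (mean W - q)
    - (1/4 - Lambda_const r \<beta> H / 8) * sq_l1_dist W q"
proof -
  have "gradient_term r \<beta> H q (mean W - q)
    = (\<Sum>s=1..r. \<beta> s * (\<Sum>e\<in>edges (H s).
          ((LINT p | unit_square. W p $ color (H s) e) - q $ color (H s) e)
            * (\<Prod>f\<in>edges (H s) - {e}. q $ color (H s) f)))
      - 1/2 * ((\<Sum>a\<in>UNIV. (LINT p | unit_square. W p $ a) * ln (q $ a)) - entropy_functional (\<lambda>_. q))"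
    by (simp add: gradient_term_def mean_def entropy_functional_const sum_subtractf left_diff_distrib)
  moreover have "(\<Sum>a\<in>UNIV. (LINT p | unit_square. W p $ a) * ln (q $ a)) + sq_l1_dist W q / 2
      \<le> entropy_functional W"
    using W q ac by (rule entropy_functional_ge)
  moreover note density_combination_first_order[OF k H W q, of \<beta>]
  moreover have "t - 1/2 * i \<le> p - 1/2 * e + g - (1/4 - K / 8) * d"
    if "g = l - 1/2 * (m - e)" "m + d / 2 \<le> i" "t \<le> p + l + K / 8 * d"
    for t i p e g l m K d :: real
    using that by (simp add: field_simps)
  ultimately show ?thesis
    unfolding J_def density_combination_const[OF H] by blast
qed

section \<open>Maximizing over constants, and the conclusion for all graphons\<close>

lemma continuous_on_const_functional:
  fixes H :: "nat \<Rightarrow> ('v, 'k::finite) cgraph"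
  assumes H: "\<forall>s\<in>{1..r}. finite_simple_cgraph (H s)"
  shows "continuous_on color_simplex
    (\<lambda>q. density_combination r \<beta> H (\<lambda>_. q) - 1/2 * entropy_functional (\<lambda>_. q))"
proof -
  have "continuous_on color_simplex (\<lambda>q :: real ^ 'k. q $ a * ln (q $ a))" for a
    by (rule continuous_on_compose2[OF continuous_on_x_ln_x])
      (auto intro!: continuous_intros simp: color_simplexD)
  then have "continuous_on color_simplex (\<lambda>q :: real ^ 'k. 1/2 * (\<Sum>a\<in>UNIV. q $ a * ln (q $ a)))"
    by (intro continuous_on_mult_left continuous_on_sum)
  moreover have "continuous_on color_simplex
      (\<lambda>q :: real ^ 'k. \<Sum>s=1..r. \<beta> s * (\<Prod>e\<in>edges (H s). q $ color (H s) e))"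
    by (intro continuous_intros)
  ultimately have "continuous_on color_simplex (\<lambda>q :: real ^ 'k.
      (\<Sum>s=1..r. \<beta> s * (\<Prod>e\<in>edges (H s). q $ color (H s) e))
        - 1/2 * (\<Sum>a\<in>UNIV. q $ a * ln (q $ a)))"
    by (rule continuous_on_diff[rotated])
  then show ?thesis
    unfolding entropy_functional_const density_combination_const[OF H] .
qed

lemma color_simplex_nonempty: "(color_simplex :: (real ^ 'k::finite) set) \<noteq> {}"
proof -
  have "axis a 1 \<in> (color_simplex :: (real ^ 'k) set)" for a
    by (auto simp: color_simplex_def axis_def)
  then show ?thesis by blast
qed

theorem theorem3p20:
  fixes r :: nat
    and \<beta> :: "nat \<Rightarrow> real"
    and H :: "nat \<Rightarrow> ('v, 'k::finite) cgraph"
  assumes "CARD('k) \<ge> 2"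
    and "\<And>s. s \<in> {1..r} \<Longrightarrow> finite_simple_cgraph (H s)"
    and "Lambda_const r \<beta> H < 2"
  defines "J \<equiv> \<lambda>W. density_combination r \<beta> H W - 1/2 * entropy_functional W"
  shows "\<exists>W. is_arg_max J (\<lambda>W. W \<in> prob_graphons) W \<and>
           (\<forall>W'. is_arg_max J (\<lambda>W. W \<in> prob_graphons) W' \<longrightarrow> (AE p in unit_square. W' p = W p)) \<and>
           (\<exists>\<mu>\<in>color_simplex. AE p in unit_square. W p = \<mu>)"
proof -
  have H: "\<forall>s\<in>{1..r}. finite_simple_cgraph (H s)" using assms(2) by blast
  define c where "c = 1/4 - Lambda_const r \<beta> H / 8"
  have "c > 0" using assms(3) by (simp add: c_def)
  have tangent: "J W \<le> J (\<lambda>_. q) + gradient_term r \<beta> H q (mean W - q) - c * sq_l1_dist W q"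
    if "W \<in> prob_graphons" "q \<in> color_simplex"
      "\<And>a. q $ a = 0 \<Longrightarrow> AE p in unit_square. W p $ a = 0" for W q
    unfolding J_def c_def by (rule tangent_upper_bound[OF assms(1) H that])
  \<comment> \<open>At \<open>q = mean W\<close> the direction \<open>mean W - q\<close> is 0, so
    the gradient term disappears.\<close>
  have le_mean: "J W \<le> J (\<lambda>_. mean W) - c * sq_l1_dist W (mean W)" if "W \<in> prob_graphons" for W
    using tangent[OF that mean_color_simplex[OF that] mean_nth_eq_0[OF that]]
    by (simp add: gradient_term_0)
  obtain \<mu> where \<mu>: "\<mu> \<in> color_simplex" and max: "\<And>q. q \<in> color_simplex \<Longrightarrow> J (\<lambda>_. q) \<le> J (\<lambda>_. \<mu>)"
    using continuous_attains_sup[OF compact_color_simplex color_simplex_nonempty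
        continuous_on_const_functional[where r = r and H = H and \<beta> = \<beta>, OF H]]
    unfolding J_def by blast
  have unique: "\<nu> = \<mu>" if \<nu>: "\<nu> \<in> color_simplex" and "J (\<lambda>_. \<nu>) = J (\<lambda>_. \<mu>)" for \<nu>
  proof -
    define q where "q = (1/2) *\<^sub>R (\<mu> + \<nu>)"
    note bounds = color_simplexD(1)[OF \<mu>] color_simplexD(1)[OF \<nu>]
    have "0 \<le> q $ a" "q $ a \<le> 1" for a
      using color_simplexD(1,2)[OF \<mu>, of a] color_simplexD(1,2)[OF \<nu>, of a] by (auto simp: q_def)
    moreover have "(\<Sum>a\<in>UNIV. q $ a) = 1"
      using \<mu> \<nu> by (simp add: q_def color_simplexD sum.distrib flip: sum_divide_distrib)
    ultimately have q: "q \<in> color_simplex" by (simp add: color_simplex_def)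
    \<comment> \<open>A coordinate of the midpoint vanishes only if it vanishes at both endpoints,
      so both may be compared with \<open>q\<close>, even on the boundary of the simplex.\<close>
    have ac: "\<mu> $ a = 0" "\<nu> $ a = 0" if "q $ a = 0" for a
      using that bounds[of a] by (auto simp: q_def add_nonneg_eq_0_iff)
    have "J (\<lambda>_. \<mu>) \<le> J (\<lambda>_. q) + gradient_term r \<beta> H q (\<mu> - q) - c * sq_l1_dist (\<lambda>_. \<mu>) q"
      using tangent[OF const_prob_graphon[OF \<mu>] q] ac(1) by (simp add: mean_const)
    moreover have "J (\<lambda>_. \<nu>) \<le> J (\<lambda>_. q) + gradient_term r \<beta> H q (\<nu> - q) - c * sq_l1_dist (\<lambda>_. \<nu>) q"
      using tangent[OF const_prob_graphon[OF \<nu>] q] ac(2) by (simp add: mean_const)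
    moreover have "gradient_term r \<beta> H q (\<mu> - q) + gradient_term r \<beta> H q (\<nu> - q) = 0"
    proof -
      have "(\<mu> - q) + (\<nu> - q) = 0" by (simp add: q_def vec_eq_iff field_simps)
      then show ?thesis by (simp add: gradient_term_0 flip: gradient_term_add)
    qed
    \<comment> \<open>Adding the two tangent bounds cancels the gradients; the value at
      \<open>q\<close> is at most the common value at \<open>\<mu>\<close> and \<open>\<nu>\<close>,
      so the penalties leave no room.\<close>
    ultimately have "c * sq_l1_dist (\<lambda>_. \<mu>) q + c * sq_l1_dist (\<lambda>_. \<nu>) q \<le> 0"
      using max[OF q] that(2) by linarith
    then have "c * sq_l1_dist (\<lambda>_. \<mu>) q = 0" "c * sq_l1_dist (\<lambda>_. \<nu>) q = 0"
      using \<open>c > 0\<close> sq_l1_dist_nonneg[of "\<lambda>_. \<mu>" q] sq_l1_dist_nonneg[of "\<lambda>_. \<nu>" q]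
      by (smt (verit) mult_nonneg_nonneg)+
    then show ?thesis
      using \<open>c > 0\<close> sq_l1_dist_const_eq_0[of \<mu> q] sq_l1_dist_const_eq_0[of \<nu> q] by simp
  qed
  have gap: "J W \<le> J (\<lambda>_. \<mu>) - c * sq_l1_dist W (mean W)" if "W \<in> prob_graphons" for W
    using le_mean[OF that] max[OF mean_color_simplex[OF that]] by linarith
  have nonneg: "0 \<le> c * sq_l1_dist W q" for W q
    using \<open>c > 0\<close> by (simp add: sq_l1_dist_nonneg)
  have arg_max: "is_arg_max J (\<lambda>W. W \<in> prob_graphons) (\<lambda>_. \<mu>)"
    unfolding is_arg_max_linorder
    using const_prob_graphon[OF \<mu>] gap nonneg by (metis diff_ge_0_iff_ge diff_left_mono diff_zero order.trans)
  have "AE p in unit_square. W' p = \<mu>" if "is_arg_max J (\<lambda>W. W \<in> prob_graphons) W'" for W'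
  proof -
    have W': "W' \<in> prob_graphons" and "J W' = J (\<lambda>_. \<mu>)"
      using that arg_max by (auto simp: is_arg_max_linorder intro: antisym)
    then have "sq_l1_dist W' (mean W') = 0"
      using gap[OF W'] nonneg[of W' "mean W'"] \<open>c > 0\<close> by simp
    \<comment> \<open>The constant at the mean does at least as well as \<open>W'\<close>, hence is
      itself a maximizer among constants, and \<open>unique\<close> identifies it.\<close>
    moreover from this have "mean W' = \<mu>"
      using le_mean[OF W'] max[OF mean_color_simplex[OF W']] \<open>J W' = J (\<lambda>_. \<mu>)\<close>
      by (intro unique mean_color_simplex[OF W']) simp
    ultimately show ?thesis using sq_l1_dist_eq_0[OF W' \<mu>] by simp
  qed
  then show ?thesis using arg_max \<mu> by blast
qed

end
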